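(* Let $(X,f_{1,\infty})$ be a non-autonomous discrete system with $f_{1,\infty}$ converging uniformly to a map $f$. If $f_{1,\infty}$ is syndetically transitive but not minimal, then $f_{1,\infty}$ is syndetically sensitive.
   Context: $\mathbb{N}=\{1,2,3,\dots\}$. A non-autonomous discrete system $(X,f_{1,\infty})$ consists of a compact metric space $(X,d)$ and a sequence $f_{1,\infty}=\{f_n\}_{n=1}^\infty$ of continuous maps $f_n:X\to X$. For $i,n\in\mathbb{N}$, $f_i^n:=f_{i+(n-1)}\circ\cdots\circ f_i$ (a composition of $n$ maps), and $f_i^0=id_X$. Uniform convergence of $f_{1,\infty}$ to $f:X\to X$ means $\sup_{x\in X}d(f_n(x),f(x))\to 0$ as $n\to\infty$. A set $A\subseteq\mathbb{N}$ is syndetic if there is a positive integer $M$ with $\{i,i+1,\dots,i+M\}\cap A\neq\emptyset$ for every $i\in\mathbb{N}$. The system is syndetically transitive if for any two nonempty open subsets $U,V\subseteq X$ the set $\{n\in\mathbb{N}: f_1^n(U)\cap V\neq\emptyset\}$ is syndetic. The system is minimal if for every $x\in X$ the orbit $\{x,f_1^1(x),f_1^2(x),\dots\}$ is dense in $X$. The system is syndetically sensitive if there exists $\delta>0$ such that for every nonempty open set $U\subseteq X$ the set $N_{f_{1,\infty}}(U,\delta)=\{n\in\mathbb{N}:\text{there exist } x,y\in U \text{ with } d(f_1^n(x),f_1^n(y))>\delta\}$ is syndetic. *)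

theory Defs
  imports "HOL-Analysis.Analysis"
begin

text \<open>
  The space $X$ is the whole type \<open>'a\<close>. Time indices start at 1, so a
  sequence is a function on \<^typ>\<open>nat\<close> of which only the values at indices \<open>\<ge> 1\<close> matter;
  the value at 0 is unconstrained and never used.
\<close>

definition nonautonomous_system :: "(nat \<Rightarrow> 'a::metric_space \<Rightarrow> 'a) \<Rightarrow> bool" where
  "nonautonomous_system f \<longleftrightarrow>
     compact (UNIV :: 'a set) \<and> (\<forall>n\<ge>1. continuous_on UNIV (f n))"

text \<open>\<open>iterate f i n\<close> is $f_i^n = f_{i+(n-1)} \circ \cdots \circ f_i$.\<close>

primrec iterate :: "(nat \<Rightarrow> 'a \<Rightarrow> 'a) \<Rightarrow> nat \<Rightarrow> nat \<Rightarrow> 'a \<Rightarrow> 'a" where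
  "iterate f i 0 = id"
| "iterate f i (Suc n) = f (i + n) \<circ> iterate f i n"

definition syndetic :: "nat set \<Rightarrow> bool" where
  "syndetic A \<longleftrightarrow> A \<subseteq> {1..} \<and> (\<exists>M>0. \<forall>i\<ge>1. {i..i + M} \<inter> A \<noteq> {})"

definition syndetically_transitive :: "(nat \<Rightarrow> 'a::metric_space \<Rightarrow> 'a) \<Rightarrow> bool" where
  "syndetically_transitive f \<longleftrightarrow>
     (\<forall>U V. open U \<and> U \<noteq> {} \<and> open V \<and> V \<noteq> {} \<longrightarrow>
        syndetic {n. n \<ge> 1 \<and> iterate f 1 n ` U \<inter> V \<noteq> {}})"

definition minimal_system :: "(nat \<Rightarrow> 'a::metric_space \<Rightarrow> 'a) \<Rightarrow> bool" where
  "minimal_system f \<longleftrightarrow> (\<forall>x. closure (range (\<lambda>n. iterate f 1 n x)) = UNIV)"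

definition sensitivity_times ::
    "(nat \<Rightarrow> 'a::metric_space \<Rightarrow> 'a) \<Rightarrow> 'a set \<Rightarrow> real \<Rightarrow> nat set" where
  "sensitivity_times f U \<delta> =
     {n. n \<ge> 1 \<and> (\<exists>x\<in>U. \<exists>y\<in>U. dist (iterate f 1 n x) (iterate f 1 n y) > \<delta>)}"

definition syndetically_sensitive :: "(nat \<Rightarrow> 'a::metric_space \<Rightarrow> 'a) \<Rightarrow> bool" where
  "syndetically_sensitive f \<longleftrightarrow>
     (\<exists>\<delta>>0. \<forall>U. open U \<and> U \<noteq> {} \<longrightarrow> syndetic (sensitivity_times f U \<delta>))"

end

theory Submission
  imports Defs
begin

text \<open>
  Let $x$ have a non-dense orbit and let $z$ be a limit point of that orbit. Since $f_n \to g$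
  uniformly, $f_n^k(w) \to g^k(z)$ as $n \to \infty$ and $w \to z$, for each fixed $k$. Hence the
  whole $g$-orbit of $z$ lies in the orbit closure of $x$ and stays away from some ball $V$. Given
  an open $U$, let $M$ bound the gaps between visits of $U$ to $V$. Syndetically often $U$ visits a
  neighbourhood of $z$ so small that the visiting point shadows the $g$-orbit of $z$ for $M$ steps;
  during these steps another point of $U$ visits $V$.
\<close>

lemma iterate_add: "iterate f i (n + k) = iterate f (i + n) k \<circ> iterate f i n"
  by (induction k) (auto simp: add.assoc)

text \<open>Induction on \<open>k\<close>: the last map applied is uniformly close to
  \<open>g\<close>, and \<open>g\<close> is continuous at \<open>(g ^^ k) z\<close>. The limit is
  joint in \<open>n\<close> and \<open>w\<close> because along an orbit the starting time and the
  starting point move together.\<close>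

lemma tendsto_iterate:
  fixes f :: "nat \<Rightarrow> 'a::metric_space \<Rightarrow> 'a"
  assumes lim: "uniform_limit UNIV f g sequentially" and cont: "continuous_on UNIV g"
  shows "((\<lambda>(n, w). iterate f n k w) \<longlongrightarrow> (g ^^ k) z) (sequentially \<times>\<^sub>F nhds z)"
proof (induction k)
  case 0
  show ?case
    by (auto simp: case_prod_unfold intro!: filterlim_snd)
next
  case (Suc k)
  let ?F = "sequentially \<times>\<^sub>F nhds z"
  show ?case
  proof (rule tendstoI)
    fix e :: real assume "e > 0"
    then have e: "e / 2 > 0" by simp
    have "isCont g ((g ^^ k) z)"
      using cont by (simp add: continuous_on_eq_continuous_at)
    from tendstoD[OF isCont_tendsto_compose[OF this Suc.IH] e]
    have A: "\<forall>\<^sub>F p in ?F. dist (g (iterate f (fst p) k (snd p))) (g ((g ^^ k) z)) < e / 2"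
      by (simp add: case_prod_unfold)
    have "\<forall>\<^sub>F n in sequentially. \<forall>x. dist (f n x) (g x) < e / 2"
      using uniform_limitD[OF lim e] by simp
    then obtain N where "\<And>n x. n \<ge> N \<Longrightarrow> dist (f n x) (g x) < e / 2"
      by (auto simp: eventually_sequentially)
    \<comment> \<open>The outermost map of \<open>iterate f n (Suc k)\<close> has index
      \<open>n + k\<close>, which is still at least \<open>N\<close>.\<close>
    then have "\<forall>\<^sub>F n in sequentially. \<forall>x. dist (f (n + k) x) (g x) < e / 2"
      by (auto simp: eventually_sequentially intro!: exI[of _ N])
    then have "\<forall>\<^sub>F p in ?F. \<forall>x. dist (f (fst p + k) x) (g x) < e / 2"
      by (rule eventually_compose_filterlim[OF _ filterlim_fst])
    with A show "\<forall>\<^sub>F p in ?F. dist (case p of (n, w) \<Rightarrow> iterate f n (Suc k) w) ((g ^^ Suc k) z) < e"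
    proof eventually_elim
      case (elim p)
      then have "dist (f (fst p + k) (iterate f (fst p) k (snd p)))
        (g (iterate f (fst p) k (snd p))) < e / 2" by blast
      then have "dist (f (fst p + k) (iterate f (fst p) k (snd p))) (g ((g ^^ k) z)) < e"
        using dist_triangle_half_r elim(1) by (metis dist_commute)
      then show ?case
        by (simp add: case_prod_unfold)
    qed
  qed
qed

lemma syndeticE:
  assumes "syndetic A"
  obtains M where "\<And>i. i \<ge> 1 \<Longrightarrow> \<exists>n\<in>A. i \<le> n \<and> n \<le> i + M"
  using assms unfolding syndetic_def by (fastforce simp: disjoint_iff)

lemma syndeticI:
  assumes "A \<subseteq> {1..}" and "\<And>i. i \<ge> 1 \<Longrightarrow> \<exists>n\<in>A. i \<le> n \<and> n \<le> i + M"
  shows "syndetic A"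
  unfolding syndetic_def
\<comment> \<open>The definition asks for a positive gap bound, while \<open>M\<close> may be 0;
  hence \<open>Suc M\<close>.\<close>
proof (intro conjI exI[of _ "Suc M"] allI impI)
  fix i :: nat assume "i \<ge> 1"
  with assms(2) obtain n where "n \<in> A" "i \<le> n" "n \<le> i + M" by blast
  then have "n \<in> {i..i + Suc M} \<inter> A" by simp
  then show "{i..i + Suc M} \<inter> A \<noteq> {}" by blast
qed (use assms(1) in auto)

text \<open>By compactness the orbit of \<open>x\<close> has a subsequence converging to some
  \<open>z\<close>. The points of the orbit \<open>k\<close> steps after those of the subsequence
  then converge to \<open>(g ^^ k) z\<close>.\<close>

lemma limit_orbit_in_orbit_closure:
  fixes f :: "nat \<Rightarrow> 'a::metric_space \<Rightarrow> 'a"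
  assumes "compact (UNIV :: 'a set)" "uniform_limit UNIV f g sequentially" "continuous_on UNIV g"
  obtains z where "\<And>k. (g ^^ k) z \<in> closure (range (\<lambda>n. iterate f 1 n x))"
proof -
  obtain z r where r: "strict_mono (r :: nat \<Rightarrow> nat)"
    and z: "((\<lambda>n. iterate f 1 n x) \<circ> r) \<longlonglongrightarrow> z"
    using assms(1) unfolding compact_def by (metis UNIV_I)
  \<comment> \<open>After \<open>r j\<close> steps from time 1, the next map to be applied has index
    \<open>1 + r j\<close>.\<close>
  have "filterlim (\<lambda>j. 1 + r j) sequentially sequentially"
    using filterlim_compose[OF filterlim_Suc filterlim_subseq[OF r]] by simp
  with z have "filterlim (\<lambda>j. (1 + r j, iterate f 1 (r j) x)) (sequentially \<times>\<^sub>F nhds z) sequentially"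
    by (intro filterlim_Pair) (auto simp: o_def)
  from filterlim_compose[OF tendsto_iterate[OF assms(2,3)] this]
  have lim: "(\<lambda>j. iterate f 1 (r j + k) x) \<longlonglongrightarrow> (g ^^ k) z" for k
    by (simp add: iterate_add)
  have "(g ^^ k) z \<in> closure (range (\<lambda>n. iterate f 1 n x))" for k
    by (rule Lim_in_closed_set[OF closed_closure _ _ lim[of k]])
      (auto intro!: always_eventually subsetD[OF closure_subset])
  then show thesis by (rule that)
qed

theorem theorem18:
  fixes f :: "nat \<Rightarrow> 'a::metric_space \<Rightarrow> 'a" and g :: "'a \<Rightarrow> 'a"
  assumes "nonautonomous_system f"
    and "uniform_limit UNIV f g sequentially"
    and "syndetically_transitive f"
    and "\<not> minimal_system f"
  shows "syndetically_sensitive f"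
proof -
  have "\<forall>\<^sub>F n in sequentially. continuous_on UNIV (f n)"
    using assms(1) by (auto simp: nonautonomous_system_def eventually_sequentially)
  from uniform_limit_theorem[OF this assms(2)] have cont: "continuous_on UNIV g" by simp
  obtain x y where y: "y \<notin> closure (range (\<lambda>n. iterate f 1 n x))"
    using assms(4) unfolding minimal_system_def by blast
  obtain z where z: "\<And>k. (g ^^ k) z \<in> closure (range (\<lambda>n. iterate f 1 n x))"
    using limit_orbit_in_orbit_closure[OF _ assms(2) cont] assms(1)
    unfolding nonautonomous_system_def by blast
  obtain e where e: "e > 0" "ball y e \<subseteq> - closure (range (\<lambda>n. iterate f 1 n x))"
    using y openE[OF open_Compl[OF closed_closure]] by (metis ComplI)
  \<comment> \<open>One quarter of the radius leaves room for two errors below \<delta> in the final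
    triangle inequality. The choice depends on \<open>y\<close> and the orbit closure only, so it
    serves every \<open>U\<close>.\<close>
  define \<delta> where "\<delta> = e / 4"
  have \<delta>: "\<delta> > 0" "4 * \<delta> \<le> dist y ((g ^^ k) z)" for k
  proof -
    show "\<delta> > 0" using e(1) by (simp add: \<delta>_def)
    have "(g ^^ k) z \<notin> ball y e" using e(2) z[of k] by blast
    then show "4 * \<delta> \<le> dist y ((g ^^ k) z)" by (simp add: \<delta>_def)
  qed
  have "syndetic (sensitivity_times f U \<delta>)" if U: "open U" "U \<noteq> {}" for U
  proof -
    have trans: "syndetic {n. n \<ge> 1 \<and> iterate f 1 n ` U \<inter> V \<noteq> {}}" if "open V" "V \<noteq> {}" for V
      using assms(3) U that unfolding syndetically_transitive_def by blast
    have "syndetic {n. n \<ge> 1 \<and> iterate f 1 n ` U \<inter> ball y \<delta> \<noteq> {}}"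
      using \<delta>(1) by (intro trans) auto
    from syndeticE[OF this] obtain M where
      M: "\<And>i. i \<ge> 1 \<Longrightarrow> \<exists>n\<ge>i. n \<le> i + M \<and> (\<exists>v\<in>U. dist y (iterate f 1 n v) < \<delta>)"
      by (auto simp: disjoint_iff) (metis (no_types, lifting) mem_ball)
    \<comment> \<open>Since \<open>M\<close> is already fixed, only finitely many \<open>k\<close>
      have to be controlled, so a single \<open>N\<close> and a single neighbourhood
      \<open>W\<close> of \<open>z\<close> suffice.\<close>
    have "\<forall>\<^sub>F p in sequentially \<times>\<^sub>F nhds z. \<forall>k\<in>{..M}.
        dist (case p of (n, w) \<Rightarrow> iterate f n k w) ((g ^^ k) z) < \<delta>"
      by (intro eventually_ball_finite ballI tendstoD[OF tendsto_iterate[OF assms(2) cont]] \<delta>(1)) simp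
    then obtain P Q where PQ: "eventually P sequentially" "eventually Q (nhds z)"
      "\<And>n w. P n \<Longrightarrow> Q w \<Longrightarrow> \<forall>k\<le>M. dist (iterate f n k w) ((g ^^ k) z) < \<delta>"
      unfolding eventually_prod_filter by auto
    obtain N where N: "\<And>n. n \<ge> N \<Longrightarrow> P n"
      using PQ(1) by (auto simp: eventually_sequentially)
    obtain W where W: "open W" "z \<in> W" "\<And>w. w \<in> W \<Longrightarrow> Q w"
      using PQ(2) by (auto simp: eventually_nhds)
    have "syndetic {n. n \<ge> 1 \<and> iterate f 1 n ` U \<inter> W \<noteq> {}}"
      using W by (intro trans) auto
    from syndeticE[OF this] obtain L where
      L: "\<And>i. i \<ge> 1 \<Longrightarrow> \<exists>n\<ge>i. n \<le> i + L \<and> (\<exists>u\<in>U. iterate f 1 n u \<in> W)"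
      by (auto simp: disjoint_iff) metis
    \<comment> \<open>From any time \<open>i\<close>, wait \<open>N\<close> steps for the maps to be
      close to \<open>g\<close>, at most \<open>L\<close> more for a visit to \<open>W\<close>, and
      at most \<open>M\<close> more for a visit to \<open>ball y \<delta>\<close>.\<close>
    show ?thesis
    proof (rule syndeticI[where M = "N + L + M"])
      fix i :: nat assume "i \<ge> 1"
      then obtain n u where n: "i + N \<le> n" "n \<le> i + N + L" and u: "u \<in> U" "iterate f 1 n u \<in> W"
        using L[of "i + N"] by auto
      obtain m v where m: "n \<le> m" "m \<le> n + M" and v: "v \<in> U" "dist y (iterate f 1 m v) < \<delta>"
        using M[of n] n \<open>i \<ge> 1\<close> by auto
      define k where "k = m - n"
      have k: "m = n + k" "k \<le> M" using m by (auto simp: k_def)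
      \<comment> \<open>At time \<open>n\<close> the point \<open>u\<close> is in \<open>W\<close>;
        from there it follows the \<open>g\<close>-orbit of \<open>z\<close> under the maps starting
        at index \<open>1 + n\<close>.\<close>
      have "dist (iterate f 1 m u) ((g ^^ k) z) < \<delta>"
        using PQ(3)[OF N W(3)[OF u(2)], of "1 + n"] n k by (auto simp: iterate_add)
      moreover have "dist y ((g ^^ k) z) \<le> dist y (iterate f 1 m v)
          + dist (iterate f 1 m v) (iterate f 1 m u) + dist (iterate f 1 m u) ((g ^^ k) z)"
        using dist_triangle[of y "(g ^^ k) z" "iterate f 1 m u"]
          dist_triangle[of y "iterate f 1 m u" "iterate f 1 m v"] by linarith
      ultimately have "dist (iterate f 1 m v) (iterate f 1 m u) > \<delta>"
        using \<delta>(1) \<delta>(2)[of k] v(2) by linarith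
      then have "m \<in> sensitivity_times f U \<delta>"
        using u v m n \<open>i \<ge> 1\<close> by (auto simp: sensitivity_times_def)
      then show "\<exists>m\<in>sensitivity_times f U \<delta>. i \<le> m \<and> m \<le> i + (N + L + M)"
        using m n by (intro bexI[of _ m]) auto
    qed (auto simp: sensitivity_times_def)
  qed
  with \<delta>(1) show ?thesis
    unfolding syndetically_sensitive_def by blast
qed

end
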